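(* Let $\{p_k\}$ be the sequence of Lagrange multipliers generated by the AIDAL method. Then $$\|p_k\|\le\|p_0\|+\frac{\beta_\lambda}{\bar d\,\sigma_A^+}=:B_p\qquad\forall k\ge1 .$$
   Context: Problem. $A:\mathbb R^n\to\mathbb R^l$ is a nonzero linear map with adjoint $A^*$, operator norm $\|A\|$ and smallest positive singular value $\sigma_A^+$; $b\in\mathbb R^l$. Consider $\min\{\phi(z):=f(z)+h(z):Az=b\}$ where: $h:\mathbb R^n\to(-\infty,\infty]$ is proper, lower semicontinuous, convex, and $K_h$-Lipschitz continuous on ${\cal H}:=\operatorname{dom}h$, which is compact with diameter $D_h$; $f:\mathbb R^n\to\mathbb R$ is differentiable and there are $0<m\le M$ with $f(u)-f(z)-\langle\nabla f(z),u-z\rangle\ge-\frac m2\|u-z\|^2$ and $\|\nabla f(u)-\nabla f(z)\|\le M\|u-z\|$ for all $u,z\in\mathbb R^n$; there is a (fixed) point $\bar z\in\operatorname{int}{\cal H}$ with $A\bar z=b$; ${\cal F}:=\{z\in{\cal H}:Az=b\}\neq\emptyset$; $\inf\phi>-\infty$. For $c>0$, $\theta\in(0,1)$, put ${\cal L}_c^\theta(z;p):=\phi(z)+(1-\theta)\langle p,Az-b\rangle+\frac c2\|Az-b\|^2$. ACG subroutine. Input: $\psi_n:\mathbb R^n\to(-\infty,\infty]$ proper closed convex; $\psi_s$ continuously differentiable, $\mu$-strongly convex with $L$-Lipschitz gradient on $\mathbb R^n$ ($0<\mu\le L$); $\sigma>0$; $x_0\in\operatorname{dom}\psi_n$. Set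 $y_0=x_0$, $A_0=0$. For $j=0,1,\dots$: let $a_j>0$ solve $a_j^2=(1+\mu A_j)(a_j+A_j)/L$; $A_{j+1}=A_j+a_j$; $\tilde x_j=\frac{A_j}{A_{j+1}}x_j+\frac{a_j}{A_{j+1}}y_j$; $x_{j+1}=\operatorname{argmin}_y\{\psi_s(\tilde x_j)+\langle\nabla\psi_s(\tilde x_j),y-\tilde x_j\rangle+\psi_n(y)+\frac{L+\mu}2\|y-\tilde x_j\|^2\}$; $y_{j+1}=y_j+\frac{a_j}{1+\mu A_{j+1}}[L(x_{j+1}-\tilde x_j)+\mu(x_{j+1}-y_j)]$; $u_{j+1}=\nabla\psi_s(x_{j+1})-\nabla\psi_s(\tilde x_j)+(L+\mu)(\tilde x_j-x_{j+1})$; if $\|u_{j+1}\|\le\sigma\|x_{j+1}-x_0\|$, stop and return $(z,v)=(x_{j+1},u_{j+1})$. AIDAL method. Input: constants $0<m\le M$ satisfying $f(u)-f(z)-\langle\nabla f(z),u-z\rangle\ge-\frac m2\|u-z\|^2$ and $\|\nabla f(u)-\nabla f(z)\|\le M\|u-z\|$ for all $u,z\in\mathbb R^n$, tolerances $\rho,\eta>0$, $z_0\in{\cal H}$, $p_0\in A(\mathbb R^n)$, $c_1>0$, $\sigma\in(0,1/2]$, $(\chi,\theta)\in(0,1)^2$ with $(1-\theta)(2-\theta)\chi\le\theta^2$. Set $\lambda=1/(2m)$. For $k=1,2,\dots$: (1) $L_k=\lambda(M+c_k\|A\|^2)+1$, $\psi_s^k(\cdot)=\lambda[{\cal L}_{c_k}^\theta(\cdot;p_{k-1})-h(\cdot)]+\frac12\|\cdot-z_{k-1}\|^2$,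 and $(z_k,v_k)$ is the output of ACG with $\psi_s=\psi_s^k$, $\psi_n=\lambda h$, $L=L_k$, $\mu=\frac12$, tolerance $\sigma$ and starting point $z_{k-1}$; (2) $\hat v_k=\frac1\lambda[v_k+z_{k-1}-z_k]$, $\hat p_k=(1-\theta)p_{k-1}+c_k(Az_k-b)$; if $\|\hat v_k\|\le\rho$ and $\|Az_k-b\|\le\eta$, stop and output $(z_k,\hat p_k,\hat v_k)$; (3) $p_k=(1-\theta)p_{k-1}+\chi c_k(Az_k-b)$; (4) $c_{k+1}=2c_k$ if $\|\hat v_k\|\le\rho$, and $c_{k+1}=c_k$ otherwise. Statements "for every $k$" refer to outer iterations $k$ that are performed; at the stopping iteration $p_k$ is also understood to be defined by the formula in (3). Constants. $\bar d$ is the distance from $\bar z$ to the boundary of ${\cal H}$; $G_f=\sup_{u\in{\cal H}}\|\nabla f(u)\|$; $\beta_\lambda=(\bar d+D_h)\left[K_h+G_f+\frac{(1+\sigma)D_h}\lambda\right]$. *)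

theory Defs
  imports "HOL-Analysis.Analysis"
begin

section \<open>Extended-real-valued convex functions\<close>

definition effdom :: "('a \<Rightarrow> ereal) \<Rightarrow> 'a set" where
  "effdom g = {x. g x < \<infinity>}"

definition proper_fun :: "('a \<Rightarrow> ereal) \<Rightarrow> bool" where
  "proper_fun g \<longleftrightarrow> (\<forall>x. g x \<noteq> -\<infinity>) \<and> effdom g \<noteq> {}"

definition lsc_fun :: "('a::topological_space \<Rightarrow> ereal) \<Rightarrow> bool" where
  "lsc_fun g \<longleftrightarrow> (\<forall>x. g x \<le> Liminf (at x) g)"

text \<open>Only used for functions that never take the value \<open>-\<infinity>\<close>, so the right-hand side is never
  of the form \<open>\<infinity> - \<infinity>\<close>; also \<open>0 * \<infinity> = 0\<close> in \<^typ>\<open>ereal\<close>, so the endpoints of the segment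
  impose nothing.\<close>

definition convex_fun :: "('a::real_vector \<Rightarrow> ereal) \<Rightarrow> bool" where
  "convex_fun g \<longleftrightarrow> (\<forall>x y. \<forall>t\<in>{0..1}.
     g ((1 - t) *\<^sub>R x + t *\<^sub>R y) \<le> ereal (1 - t) * g x + ereal t * g y)"


section \<open>Gradients and singular values\<close>

definition grad :: "('a::real_inner \<Rightarrow> real) \<Rightarrow> 'a \<Rightarrow> 'a" where
  "grad g x = (THE D. GDERIV g x :> D)"

lemma grad_eqI:
  assumes "GDERIV g x :> D"
  shows "grad g x = D"
  unfolding grad_def
proof (rule the_equality[where a = D])
  fix D' assume "GDERIV g x :> D'"
  then have "(\<lambda>h. inner h D') = (\<lambda>h. inner h D)"
    using assms has_derivative_unique unfolding gderiv_def by blast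
  then show "D' = D"
    by (metis vector_eq_ldot)
qed (fact assms)

text \<open>The singular values of a linear map are the nonnegative square roots of the eigenvalues of
  \<open>A\<^sup>* A\<close>.\<close>

definition singular_value ::
    "('a::euclidean_space \<Rightarrow> 'b::euclidean_space) \<Rightarrow> real \<Rightarrow> bool" where
  "singular_value A s \<longleftrightarrow> s \<ge> 0 \<and> (\<exists>x. x \<noteq> 0 \<and> adjoint A (A x) = s\<^sup>2 *\<^sub>R x)"

definition min_pos_singular_value ::
    "('a::euclidean_space \<Rightarrow> 'b::euclidean_space) \<Rightarrow> real" where
  "min_pos_singular_value A = (LEAST s. s > 0 \<and> singular_value A s)"


section \<open>The ACG subroutine\<close>

text \<open>\<open>acg_output \<psi>s \<psi>n L \<mu> \<sigma> x0 (zz, vv)\<close>: the subroutine terminates and returns \<open>(zz, vv)\<close>.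
  The scalar called \<open>A_j\<close> in the usual presentation is \<open>S j\<close> here; \<open>J\<close> is the first index at
  which the stopping test succeeds.\<close>

definition acg_output ::
    "('a::euclidean_space \<Rightarrow> real) \<Rightarrow> ('a \<Rightarrow> ereal) \<Rightarrow> real \<Rightarrow> real \<Rightarrow> real \<Rightarrow> 'a \<Rightarrow> 'a \<times> 'a \<Rightarrow> bool"
where
  "acg_output \<psi>s \<psi>n L \<mu> \<sigma> x0 out \<longleftrightarrow>
    (\<exists>(J::nat) (x::nat \<Rightarrow> 'a) (y::nat \<Rightarrow> 'a) (xt::nat \<Rightarrow> 'a) (u::nat \<Rightarrow> 'a)
       (a::nat \<Rightarrow> real) (S::nat \<Rightarrow> real).
       x 0 = x0 \<and> y 0 = x0 \<and> S 0 = 0 \<and>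
       (\<forall>j\<le>J.
          a j > 0 \<and> (a j)\<^sup>2 = (1 + \<mu> * S j) * (a j + S j) / L \<and>
          S (Suc j) = S j + a j \<and>
          xt j = (S j / S (Suc j)) *\<^sub>R x j + (a j / S (Suc j)) *\<^sub>R y j \<and>
          is_arg_min
            (\<lambda>w. ereal (\<psi>s (xt j) + grad \<psi>s (xt j) \<bullet> (w - xt j)) + \<psi>n w
                  + ereal ((L + \<mu>) / 2 * (norm (w - xt j))\<^sup>2))
            (\<lambda>_. True) (x (Suc j)) \<and>
          y (Suc j) = y j + (a j / (1 + \<mu> * S (Suc j))) *\<^sub>R
            (L *\<^sub>R (x (Suc j) - xt j) + \<mu> *\<^sub>R (x (Suc j) - y j)) \<and>
          u (Suc j) = grad \<psi>s (x (Suc j)) - grad \<psi>s (xt j) + (L + \<mu>) *\<^sub>R (xt j - x (Suc j))) \<and>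
       (\<forall>j<J. \<not> norm (u (Suc j)) \<le> \<sigma> * norm (x (Suc j) - x 0)) \<and>
       norm (u (Suc J)) \<le> \<sigma> * norm (x (Suc J) - x 0) \<and>
       out = (x (Suc J), u (Suc J)))"


section \<open>The AIDAL method\<close>

text \<open>The function \<open>z \<mapsto> L(z; p) - h z\<close> for the theta-damped augmented Lagrangian
  \<open>L(z; p) = f z + h z + (1 - \<theta>) \<langle>p, A z - b\<rangle> + c/2 \<parallel>A z - b\<parallel>\<^sup>2\<close>. It is defined directly because
  the difference would read \<open>\<infinity> - \<infinity>\<close> outside the domain of \<open>h\<close>.\<close>

definition smooth_lagrangian ::
    "('a::euclidean_space \<Rightarrow> real) \<Rightarrow> ('a \<Rightarrow> 'b::euclidean_space) \<Rightarrow> 'b \<Rightarrow> real \<Rightarrow> real \<Rightarrow> 'a \<Rightarrow> 'b \<Rightarrow> real"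
where
  "smooth_lagrangian f A b \<theta> c z p =
     f z + (1 - \<theta>) * (p \<bullet> (A z - b)) + c / 2 * (norm (A z - b))\<^sup>2"

text \<open>The outer iterations \<open>1, \<dots>, N\<close> have been performed. The stopping test fails at every
  iteration before \<open>N\<close>; iteration \<open>N\<close> may or may not be the stopping one. A nonterminating
  execution is covered through its prefixes. The multiplier \<open>p N\<close> is defined by the update formula
  also when the method stops at \<open>N\<close>.\<close>

definition aidal_run ::
    "('a::euclidean_space \<Rightarrow> real) \<Rightarrow> ('a \<Rightarrow> ereal) \<Rightarrow> ('a \<Rightarrow> 'b::euclidean_space) \<Rightarrow> 'b \<Rightarrow>
     real \<Rightarrow> real \<Rightarrow> real \<Rightarrow> real \<Rightarrow> 'a \<Rightarrow> 'b \<Rightarrow> real \<Rightarrow> real \<Rightarrow> real \<Rightarrow> real \<Rightarrow> nat \<Rightarrow>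
     (nat \<Rightarrow> 'a) \<Rightarrow> (nat \<Rightarrow> 'a) \<Rightarrow> (nat \<Rightarrow> 'a) \<Rightarrow> (nat \<Rightarrow> 'b) \<Rightarrow> (nat \<Rightarrow> 'b) \<Rightarrow> (nat \<Rightarrow> real) \<Rightarrow> bool"
where
  "aidal_run f h A b m M \<rho> \<eta> z0 p0 c1 \<sigma> chi \<theta> N z v vhat phat p c \<longleftrightarrow>
    (let lam = 1 / (2 * m) in
      z 0 = z0 \<and> p 0 = p0 \<and> c 1 = c1 \<and>
      (\<forall>k\<in>{1..N}.
         acg_output
           (\<lambda>x. lam * smooth_lagrangian f A b \<theta> (c k) x (p (k - 1)) + 1 / 2 * (norm (x - z (k - 1)))\<^sup>2)
           (\<lambda>x. ereal lam * h x)
           (lam * (M + c k * (onorm A)\<^sup>2) + 1) (1 / 2) \<sigma> (z (k - 1)) (z k, v k) \<and>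
         vhat k = (1 / lam) *\<^sub>R (v k + z (k - 1) - z k) \<and>
         phat k = (1 - \<theta>) *\<^sub>R p (k - 1) + c k *\<^sub>R (A (z k) - b) \<and>
         p k = (1 - \<theta>) *\<^sub>R p (k - 1) + (chi * c k) *\<^sub>R (A (z k) - b)) \<and>
      (\<forall>k\<in>{1..<N}.
         \<not> (norm (vhat k) \<le> \<rho> \<and> norm (A (z k) - b) \<le> \<eta>) \<and>
         c (Suc k) = (if norm (vhat k) \<le> \<rho> then 2 * c k else c k)))"

end

theory Submission
  imports Defs
begin

text \<open>
  Write \<open>q\<^sub>k\<close> for \<open>phat k\<close>, \<open>d\<close> for the distance from \<open>z_bar\<close> to the boundary of \<open>H\<close> and
  \<open>s\<close> for the smallest positive singular value of \<open>A\<close>. The optimality condition of the proximal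
  step inside the accelerated gradient subroutine says that the residual \<open>v\<^sub>k\<close> is the gradient of
  the smooth part at \<open>z\<^sub>k\<close> plus a subgradient of the nonsmooth part
  (\<open>acg_output_subgradient\<close>). Dividing by \<open>lam\<close>, the vector
  \<open>\<xi>\<^sub>k = vhat k - \<nabla>f(z\<^sub>k) - A\<^sup>* q\<^sub>k\<close> is a subgradient of \<open>h\<close> at \<open>z\<^sub>k\<close>, and
  \<open>\<parallel>vhat k\<parallel> \<le> (1 + \<sigma>) D_h / lam\<close>.

  Since \<open>h\<close> is Lipschitz on \<open>H\<close> and the ball of radius \<open>d\<close> around \<open>z_bar\<close> lies in \<open>H\<close>, the
  subgradient inequality tested at \<open>z_bar + d \<xi>\<^sub>k / \<parallel>\<xi>\<^sub>k\<parallel>\<close> bounds \<open>d \<parallel>\<xi>\<^sub>k\<parallel>\<close>. As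
  \<open>A z_bar = b\<close>, this gives (\<open>approximate_kkt_multiplier_bound\<close>)
  \<open>d \<parallel>A\<^sup>* q\<^sub>k\<parallel> + \<langle>q\<^sub>k, A z\<^sub>k - b\<rangle> \<le> \<beta>_lam\<close>.
  All multipliers lie in the range of \<open>A\<close>, where \<open>\<parallel>A\<^sup>* y\<parallel> \<ge> s \<parallel>y\<parallel>\<close>
  (\<open>min_pos_singular_value_adjoint_bound\<close>).

  Because \<open>c\<^sub>k (A z\<^sub>k - b) = q\<^sub>k - (1 - \<theta>) p(k - 1)\<close>, the inner product is nonnegative whenever
  \<open>\<parallel>q\<^sub>k\<parallel> \<ge> (1 - \<theta>) \<parallel>p(k - 1)\<parallel>\<close>, whatever the size of \<open>c\<^sub>k\<close>. So
  \<open>\<parallel>q\<^sub>k\<parallel> \<le> max ((1 - \<theta>) \<parallel>p(k - 1)\<parallel>) (\<beta>_lam / (d s))\<close>, and \<open>p\<^sub>k\<close> obeys the same bound, being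
  the convex combination \<open>chi q\<^sub>k + (1 - chi) (1 - \<theta>) p(k - 1)\<close>
  (\<open>damped_multiplier_bound\<close>). Induction on \<open>k\<close> concludes.
\<close>

section \<open>The smallest positive singular value\<close>

text \<open>The passage to the limit \<open>t \<rightarrow> 0\<close> in a first-order optimality condition.\<close>

lemma linear_coeff_nonneg:
  fixes a q :: real
  assumes "\<And>t. 0 < t \<Longrightarrow> t \<le> 1 \<Longrightarrow> 0 \<le> t * a + t\<^sup>2 * q"
  shows "0 \<le> a"
proof (rule ccontr)
  assume "\<not> 0 \<le> a"
  then have a: "a < 0" by simp
  define t where "t = min 1 (- a / (2 * (\<bar>q\<bar> + 1)))"
  have t: "0 < t" "t \<le> 1" "t \<le> - a / (2 * (\<bar>q\<bar> + 1))"
    using a by (auto simp: t_def divide_neg_pos)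
  have "t * (2 * (\<bar>q\<bar> + 1)) \<le> - a"
    using t(3) by (subst (asm) pos_le_divide_eq) auto
  moreover have "t * q \<le> t * (\<bar>q\<bar> + 1)"
    using t(1) by (intro mult_left_mono) auto
  ultimately have "a + t * q < 0"
    using a by (simp add: algebra_simps)
  then have "t * (a + t * q) < 0"
    using t(1) by (simp add: mult_pos_neg)
  then show False
    using assms[OF t(1,2)] by (simp add: power2_eq_square algebra_simps)
qed

lemma exists_ortho_kernel_preimage:
  fixes A :: "'a::euclidean_space \<Rightarrow> 'b::euclidean_space"
  assumes "linear A"
  obtains w where "A w = A x" "\<And>k. A k = 0 \<Longrightarrow> w \<bullet> k = 0"
proof -
  obtain u w where uw: "u \<in> span {k. A k = 0}" "\<And>k. k \<in> span {k. A k = 0} \<Longrightarrow> orthogonal w k"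
      "x = u + w"
    using orthogonal_subspace_decomp_exists[of "{k. A k = 0}" x] by blast
  have "subspace {k. A k = 0}"
    using assms by (auto simp: subspace_def linear_0 linear_add linear_scale)
  then have "A u = 0"
    using uw(1) by (simp add: span_eq_iff[THEN iffD2])
  then have "A w = A x"
    using uw(3) assms by (simp add: linear_add)
  moreover have "w \<bullet> k = 0" if "A k = 0" for k
    using uw(2)[of k] that by (simp add: span_base orthogonal_def)
  ultimately show ?thesis by (rule that)
qed

text \<open>The least element in the definition of the smallest positive singular value exists: it is the
  minimum of \<open>\<parallel>A x\<parallel>\<close> over the unit sphere of the orthogonal complement of the kernel of \<open>A\<close>.\<close>

lemma min_pos_singular_value_lower_bound:
  fixes A :: "'a::euclidean_space \<Rightarrow> 'b::euclidean_space"
  assumes lin: "linear A" and nz: "A \<noteq> (\<lambda>_. 0)"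
  shows "0 < min_pos_singular_value A"
    and "\<And>x. (\<And>k. A k = 0 \<Longrightarrow> x \<bullet> k = 0) \<Longrightarrow> min_pos_singular_value A * norm x \<le> norm (A x)"
proof -
  define W where "W = {x. \<forall>k. A k = 0 \<longrightarrow> x \<bullet> k = 0}"
  have subW: "subspace W"
    unfolding W_def by (auto simp: subspace_def inner_add_left)
  have adj: "adjoint A y \<bullet> x = y \<bullet> A x" for x y
    using adjoint_works[OF lin, of x y] by (simp add: inner_commute)
  have adjW: "adjoint A y \<in> W" for y
    unfolding W_def by (simp add: adj)
  have A0: "A 0 = 0" using lin by (rule linear_0)
  obtain x1 where "A x1 \<noteq> 0" using nz by auto
  moreover obtain w where w: "A w = A x1" "w \<in> W"
    using exists_ortho_kernel_preimage[OF lin, of x1] unfolding W_def by blast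
  ultimately have "w \<noteq> 0" using A0 by auto
  then have "(1 / norm w) *\<^sub>R w \<in> W \<inter> sphere 0 1"
    using w(2) subW by (simp add: subspace_scale)
  then have ne: "W \<inter> sphere 0 1 \<noteq> {}" by blast
  have "compact (W \<inter> sphere 0 1)"
    using subW by (intro closed_Int_compact closed_subspace) auto
  moreover have "continuous_on (W \<inter> sphere 0 1) (\<lambda>x. norm (A x))"
    using lin by (intro continuous_on_norm linear_continuous_on)
      (simp add: linear_conv_bounded_linear)
  ultimately obtain e where e: "e \<in> W" "norm e = 1"
      and emin: "\<And>x. x \<in> W \<Longrightarrow> norm x = 1 \<Longrightarrow> norm (A e) \<le> norm (A x)"
    using continuous_attains_inf[OF _ ne, of "\<lambda>x. norm (A x)"] by auto
  define s where "s = norm (A e)"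
  have low: "s * norm x \<le> norm (A x)" if "x \<in> W" for x
  proof (cases "x = 0")
    case False
    have "s \<le> norm (A ((1 / norm x) *\<^sub>R x))"
      unfolding s_def using False that subW by (intro emin) (auto simp: subspace_scale)
    also have "\<dots> = norm (A x) / norm x"
      using lin by (simp add: linear_scale)
    finally show ?thesis using False by (simp add: field_simps)
  qed simp
  have "A e \<noteq> 0"
  proof
    assume "A e = 0"
    then have "e \<bullet> e = 0" using e(1) unfolding W_def by blast
    then show False using e(2) by simp
  qed
  then have spos: "0 < s" by (simp add: s_def)
  define g where "g = adjoint A (A e) - s\<^sup>2 *\<^sub>R e"
  have gW: "g \<in> W" unfolding g_def
    using subW e(1) adjW by (intro subspace_diff subspace_scale)
  \<comment> \<open>The form \<open>\<parallel>A x\<parallel>\<^sup>2 - s\<^sup>2 \<parallel>x\<parallel>\<^sup>2\<close> is nonnegative on \<open>W\<close> and vanishes at \<open>e\<close>; half its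
    gradient at \<open>e\<close> is \<open>g\<close>. Since \<open>g\<close> lies in \<open>W\<close>, moving from \<open>e\<close> along \<open>- g\<close> shows \<open>g = 0\<close>.\<close>
  have "0 \<le> - 2 * (g \<bullet> g)"
  proof (rule linear_coeff_nonneg[where q = "(norm (A g))\<^sup>2 - s\<^sup>2 * (norm g)\<^sup>2"])
    fix t :: real
    have "e - t *\<^sub>R g \<in> W"
      using subW e(1) gW by (intro subspace_diff subspace_scale)
    then have "(s * norm (e - t *\<^sub>R g))\<^sup>2 \<le> (norm (A (e - t *\<^sub>R g)))\<^sup>2"
      using spos by (intro power_mono low) auto
    moreover have "A (e - t *\<^sub>R g) = A e - t *\<^sub>R A g"
      using lin by (simp add: linear_diff linear_scale)
    moreover have "(norm (A e - t *\<^sub>R A g))\<^sup>2 = s\<^sup>2 - 2 * t * (A e \<bullet> A g) + t\<^sup>2 * (norm (A g))\<^sup>2"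
      unfolding s_def power2_norm_eq_inner
      by (simp add: inner_diff_left inner_diff_right inner_commute algebra_simps power2_eq_square)
    moreover have "(norm (e - t *\<^sub>R g))\<^sup>2 = 1 - 2 * t * (e \<bullet> g) + t\<^sup>2 * (norm g)\<^sup>2"
      using e(2) unfolding norm_eq_1 power2_norm_eq_inner
      by (simp add: inner_diff_left inner_diff_right inner_commute algebra_simps power2_eq_square)
    moreover
    have "g \<bullet> g = A e \<bullet> A g - s\<^sup>2 * (e \<bullet> g)"
    proof -
      have "g \<bullet> g = adjoint A (A e) \<bullet> g - s\<^sup>2 * (e \<bullet> g)"
        by (subst (1) g_def) (simp add: inner_diff_left)
      then show ?thesis by (simp add: adj)
    qed
    then have "t * (- 2 * (g \<bullet> g)) = - (2 * t * (A e \<bullet> A g)) + s\<^sup>2 * (2 * t * (e \<bullet> g))"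
      by (simp only:) (simp add: algebra_simps)
    ultimately show "0 \<le> t * (- 2 * (g \<bullet> g)) + t\<^sup>2 * ((norm (A g))\<^sup>2 - s\<^sup>2 * (norm g)\<^sup>2)"
      by (simp add: power_mult_distrib algebra_simps)
  qed
  then have "g = 0"
    by (metis inner_ge_zero inner_eq_zero_iff mult_minus_left neg_0_le_iff_le order_antisym
        zero_less_numeral mult_le_0_iff not_numeral_le_zero)
  then have "singular_value A s"
    unfolding singular_value_def using spos e(2) by (intro conjI exI[of _ e]) (auto simp: g_def)
  moreover have "s \<le> t" if t: "0 < t" "singular_value A t" for t
  proof -
    obtain x where x: "x \<noteq> 0" "adjoint A (A x) = t\<^sup>2 *\<^sub>R x"
      using t(2) unfolding singular_value_def by blast
    then have "x = (1 / t\<^sup>2) *\<^sub>R adjoint A (A x)" using t(1) by simp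
    then have "x \<in> W" using adjW subW by (metis subspace_scale)
    then have "s * norm x \<le> norm (A x)" by (rule low)
    moreover have "(norm (A x))\<^sup>2 = (t * norm x)\<^sup>2"
      using adj[of "A x" x] x(2) by (simp add: power2_norm_eq_inner power_mult_distrib)
    then have "norm (A x) = t * norm x"
      using t(1) by (simp add: power2_eq_iff_nonneg)
    ultimately show ?thesis using x(1) by simp
  qed
  ultimately have "min_pos_singular_value A = s"
    unfolding min_pos_singular_value_def using spos by (intro Least_equality) auto
  then show "0 < min_pos_singular_value A"
    and "\<And>x. (\<And>k. A k = 0 \<Longrightarrow> x \<bullet> k = 0) \<Longrightarrow> min_pos_singular_value A * norm x \<le> norm (A x)"
    using spos low unfolding W_def by auto
qed

lemma min_pos_singular_value_adjoint_bound:
  fixes A :: "'a::euclidean_space \<Rightarrow> 'b::euclidean_space"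
  assumes lin: "linear A" and nz: "A \<noteq> (\<lambda>_. 0)" and y: "y \<in> range A"
  shows "min_pos_singular_value A * norm y \<le> norm (adjoint A y)"
proof (cases "y = 0")
  case False
  obtain x where x: "A x = y" "\<And>k. A k = 0 \<Longrightarrow> x \<bullet> k = 0"
    using y exists_ortho_kernel_preimage[OF lin] by (metis imageE)
  have "x \<noteq> 0" using x(1) False linear_0[OF lin] by auto
  let ?s = "min_pos_singular_value A"
  have "(?s * norm y) * norm x \<le> norm y * norm y"
    using mult_right_mono[OF min_pos_singular_value_lower_bound(2)[OF lin nz x(2)], of "norm y"] x(1)
    by (simp add: mult_ac)
  also have "\<dots> = x \<bullet> adjoint A y"
    using adjoint_works[OF lin, of x y] x(1) by (simp add: norm_eq_sqrt_inner)
  also have "\<dots> \<le> norm (adjoint A y) * norm x"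
    using norm_cauchy_schwarz[of x "adjoint A y"] by (simp add: mult.commute)
  finally show ?thesis using \<open>x \<noteq> 0\<close> by simp
qed simp

section \<open>The residual of the accelerated gradient subroutine as a subgradient\<close>

text \<open>Here and in the next lemma the extended-valued function is given by its effective domain \<open>S\<close> and a
  real-valued function \<open>g\<close> that is convex on \<open>S\<close>. The vector \<open>d\<close> is arbitrary; no relation to a
  gradient is needed.\<close>

lemma prox_argmin_subgradient:
  fixes \<psi> :: "'a::real_inner \<Rightarrow> ereal" and g :: "'a \<Rightarrow> real"
  assumes \<psi>: "\<And>w. \<psi> w = (if w \<in> S then ereal (g w) else \<infinity>)"
    and conv: "convex_on S g" and ne: "S \<noteq> {}"
    and min: "is_arg_min (\<lambda>w. ereal (\<alpha> + d \<bullet> (w - y)) + \<psi> w + ereal (\<kappa> / 2 * (norm (w - y))\<^sup>2))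
      (\<lambda>_. True) x"
  shows "x \<in> S"
    and "\<And>w. w \<in> S \<Longrightarrow> g x + (\<kappa> *\<^sub>R (y - x) - d) \<bullet> (w - x) \<le> g w"
proof -
  let ?F = "\<lambda>w. ereal (\<alpha> + d \<bullet> (w - y)) + \<psi> w + ereal (\<kappa> / 2 * (norm (w - y))\<^sup>2)"
  have le: "?F x \<le> ?F w" for w
    using min by (auto simp: is_arg_min_def not_less)
  show xS: "x \<in> S"
  proof (rule ccontr)
    assume "x \<notin> S"
    moreover obtain w where "w \<in> S" using ne by blast
    ultimately show False using le[of w] by (simp add: \<psi>)
  qed
  fix w assume w: "w \<in> S"
  have "0 \<le> g w - g x - (\<kappa> *\<^sub>R (y - x) - d) \<bullet> (w - x)"
  proof (rule linear_coeff_nonneg[where q = "\<kappa> / 2 * (norm (w - x))\<^sup>2"])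
    fix t :: real assume t: "0 < t" "t \<le> 1"
    let ?w = "(1 - t) *\<^sub>R x + t *\<^sub>R w"
    have wS: "?w \<in> S"
      using convex_on_imp_convex[OF conv] xS w t by (simp add: convexD_alt)
    have e: "?w - y = (x - y) + t *\<^sub>R (w - x)"
      by (simp add: algebra_simps)
    have "g ?w \<le> (1 - t) * g x + t * g w"
      using conv xS w t by (simp add: convex_onD)
    moreover have "\<alpha> + d \<bullet> (x - y) + g x + \<kappa> / 2 * (norm (x - y))\<^sup>2
        \<le> \<alpha> + d \<bullet> (?w - y) + g ?w + \<kappa> / 2 * (norm (?w - y))\<^sup>2"
      using le[of ?w] xS wS by (simp add: \<psi>)
    moreover have "d \<bullet> (?w - y) = d \<bullet> (x - y) + t * (d \<bullet> (w - x))"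
      unfolding e by (simp add: inner_add_right)
    moreover have "(norm (?w - y))\<^sup>2
        = (norm (x - y))\<^sup>2 + 2 * t * ((x - y) \<bullet> (w - x)) + t\<^sup>2 * (norm (w - x))\<^sup>2"
      unfolding e power2_norm_eq_inner
      by (simp add: inner_add_left inner_add_right inner_commute power2_eq_square algebra_simps)
    then have "\<kappa> / 2 * (norm (?w - y))\<^sup>2 = \<kappa> / 2 * (norm (x - y))\<^sup>2
        + t * (\<kappa> * ((x - y) \<bullet> (w - x))) + t\<^sup>2 * (\<kappa> / 2 * (norm (w - x))\<^sup>2)"
      by (simp only:) (simp add: field_simps)
    moreover have "(\<kappa> *\<^sub>R (y - x) - d) \<bullet> (w - x)
        = - (\<kappa> * ((x - y) \<bullet> (w - x))) - d \<bullet> (w - x)"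
      by (simp add: inner_diff_left algebra_simps)
    then have "t * (g w - g x - (\<kappa> *\<^sub>R (y - x) - d) \<bullet> (w - x))
        = t * g w - t * g x + t * (\<kappa> * ((x - y) \<bullet> (w - x))) + t * (d \<bullet> (w - x))"
      by (simp only:) (simp add: algebra_simps)
    moreover have "(1 - t) * g x = g x - t * g x" by (simp add: algebra_simps)
    ultimately show "0 \<le> t * (g w - g x - (\<kappa> *\<^sub>R (y - x) - d) \<bullet> (w - x))
        + t\<^sup>2 * (\<kappa> / 2 * (norm (w - x))\<^sup>2)"
      by linarith
  qed
  then show "g x + (\<kappa> *\<^sub>R (y - x) - d) \<bullet> (w - x) \<le> g w" by simp
qed

text \<open>Only the last inner iteration enters: its argmin condition supplies a subgradient in terms of
  the gradient at the extrapolated point \<open>xt\<close>, and the definition of \<open>u\<close> exchanges that gradient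
  for the one at \<open>x\<close>.\<close>

lemma acg_output_subgradient:
  fixes \<psi>n :: "'a::euclidean_space \<Rightarrow> ereal" and g :: "'a \<Rightarrow> real"
  assumes \<psi>n: "\<And>w. \<psi>n w = (if w \<in> S then ereal (g w) else \<infinity>)"
    and conv: "convex_on S g" and ne: "S \<noteq> {}"
    and out: "acg_output \<psi>s \<psi>n L \<mu> \<sigma> x0 (x, u)"
  shows "x \<in> S" and "norm u \<le> \<sigma> * norm (x - x0)"
    and "\<And>w. w \<in> S \<Longrightarrow> g x + (u - grad \<psi>s x) \<bullet> (w - x) \<le> g w"
proof -
  from out obtain xt where
    min: "is_arg_min (\<lambda>w. ereal (\<psi>s xt + grad \<psi>s xt \<bullet> (w - xt)) + \<psi>n w
      + ereal ((L + \<mu>) / 2 * (norm (w - xt))\<^sup>2)) (\<lambda>_. True) x"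
    and u: "u = grad \<psi>s x - grad \<psi>s xt + (L + \<mu>) *\<^sub>R (xt - x)"
    and bound: "norm u \<le> \<sigma> * norm (x - x0)"
    unfolding acg_output_def by blast
  note sub = prox_argmin_subgradient[OF \<psi>n conv ne min]
  show "x \<in> S" by (rule sub(1))
  show "norm u \<le> \<sigma> * norm (x - x0)" by (rule bound)
  show "g x + (u - grad \<psi>s x) \<bullet> (w - x) \<le> g w" if "w \<in> S" for w
  proof -
    have "u - grad \<psi>s x = (L + \<mu>) *\<^sub>R (xt - x) - grad \<psi>s xt" using u by simp
    then show ?thesis using sub(2)[OF that] by simp
  qed
qed

lemma GDERIV_grad:
  fixes f :: "'a::euclidean_space \<Rightarrow> real"
  assumes "f differentiable (at x)"
  shows "GDERIV f x :> grad f x"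
proof -
  obtain f' where f': "(f has_derivative f') (at x)"
    using assms by (auto simp: differentiable_def)
  then have "linear f'" by (rule has_derivative_linear)
  then have "f' = (\<lambda>y. y \<bullet> adjoint f' 1)"
    using adjoint_works[of f' _ 1] by auto
  then have "GDERIV f x :> adjoint f' 1"
    using f' unfolding gderiv_def by simp
  then show ?thesis using grad_eqI by metis
qed

text \<open>The argument of \<open>adjoint A\<close> is the tentative multiplier \<open>phat\<close> of the outer iteration.\<close>

lemma grad_prox_smooth_lagrangian:
  fixes A :: "'a::euclidean_space \<Rightarrow> 'b::euclidean_space"
  assumes lin: "linear A" and f: "f differentiable (at x)"
  shows "grad (\<lambda>x. lam * smooth_lagrangian f A b \<theta> c x p + 1 / 2 * (norm (x - y))\<^sup>2) x
    = lam *\<^sub>R (grad f x + adjoint A ((1 - \<theta>) *\<^sub>R p + c *\<^sub>R (A x - b))) + (x - y)"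
proof (rule grad_eqI)
  have lin': "linear (adjoint A)" using lin by (rule adjoint_linear)
  have df: "(f has_derivative (\<lambda>w. w \<bullet> grad f x)) (at x)"
    using GDERIV_grad[OF f] by (simp add: gderiv_def)
  have dA: "(A has_derivative A) (at x)"
    using lin by (simp add: bounded_linear_imp_has_derivative linear_conv_bounded_linear)
  have "((\<lambda>x. lam * smooth_lagrangian f A b \<theta> c x p + 1 / 2 * (norm (x - y))\<^sup>2) has_derivative
     (\<lambda>w. lam * (w \<bullet> grad f x + (1 - \<theta>) * (p \<bullet> A w) + c / 2 * (2 * (A w \<bullet> (A x - b))))
       + 1 / 2 * (2 * (w \<bullet> (x - y))))) (at x)"
    unfolding smooth_lagrangian_def power2_norm_eq_inner
    by (rule derivative_eq_intros df dA refl | simp add: inner_commute)+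
  then show "GDERIV (\<lambda>x. lam * smooth_lagrangian f A b \<theta> c x p + 1 / 2 * (norm (x - y))\<^sup>2) x
    :> lam *\<^sub>R (grad f x + adjoint A ((1 - \<theta>) *\<^sub>R p + c *\<^sub>R (A x - b))) + (x - y)"
    unfolding gderiv_def
    by (rule has_derivative_eq_rhs)
      (simp add: fun_eq_iff inner_add_right adjoint_works[OF lin] inner_commute algebra_simps)
qed

section \<open>Bounding the multipliers\<close>

lemma cball_infdist_frontier_subset:
  fixes x :: "'a::euclidean_space"
  assumes "closed H" "x \<in> H"
  shows "cball x (infdist x (frontier H)) \<subseteq> H"
proof (cases "infdist x (frontier H) = 0")
  case False
  let ?d = "infdist x (frontier H)"
  have d: "0 < ?d" using False infdist_nonneg[of x "frontier H"] by linarith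
  have "ball x ?d \<inter> frontier H = {}"
    using infdist_le[of _ "frontier H" x] by (fastforce simp: not_less)
  then have "ball x ?d \<subseteq> H"
    using connected_Int_frontier[of "ball x ?d" H] assms(2) d centre_in_ball[of x ?d]
    by (metis Diff_eq_empty_iff IntI connected_ball empty_iff)
  then have "closure (ball x ?d) \<subseteq> H"
    using assms(1) by (rule closure_minimal)
  then show ?thesis using d by simp
qed (use assms in simp)

lemma subgradient_norm_bound:
  fixes \<xi> :: "'a::real_inner"
  assumes lip: "K-lipschitz_on H g" and ball: "cball y d \<subseteq> H" and d: "0 \<le> d"
    and x: "x \<in> H" and sub: "\<And>w. w \<in> H \<Longrightarrow> g x + \<xi> \<bullet> (w - x) \<le> g w"
  shows "d * norm \<xi> \<le> K * (d + dist x y) + \<xi> \<bullet> (x - y)"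
proof -
  \<comment> \<open>The test point lies at distance \<open>d\<close> from \<open>y\<close> in the direction of \<open>\<xi>\<close>; for \<open>\<xi> = 0\<close> it is \<open>y\<close>.\<close>
  define w where "w = y + (d / norm \<xi>) *\<^sub>R \<xi>"
  have dw: "dist y w \<le> d" using d by (simp add: w_def dist_norm)
  then have wH: "w \<in> H" using ball by auto
  have "K \<ge> 0" using lip by (rule lipschitz_on_nonneg)
  have "g w - g x \<le> K * dist w x"
    using lipschitz_onD[OF lip wH x] by (simp add: dist_real_def)
  also have "\<dots> \<le> K * (d + dist x y)"
    using dw dist_triangle[of w x y] \<open>K \<ge> 0\<close>
    by (intro mult_left_mono) (auto simp: dist_commute)
  finally have "\<xi> \<bullet> (w - x) \<le> K * (d + dist x y)"
    using sub[OF wH] by simp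
  moreover have "\<xi> \<bullet> (w - x) = d * norm \<xi> - \<xi> \<bullet> (x - y)"
    by (simp add: w_def inner_diff_right inner_add_right dot_square_norm power2_eq_square)
  ultimately show ?thesis by simp
qed

text \<open>Here \<open>s\<close> plays the role of the gradient of the smooth objective at \<open>x\<close>, \<open>q\<close> is a
  multiplier and \<open>r\<close> is the residual in the stationarity condition.\<close>

lemma approximate_kkt_multiplier_bound:
  fixes A :: "'a::euclidean_space \<Rightarrow> 'b::euclidean_space"
  assumes lin: "linear A" and Ay: "A y = b"
    and lip: "K-lipschitz_on H g" and ball: "cball y d \<subseteq> H" and d: "0 \<le> d"
    and x: "x \<in> H"
    and sub: "\<And>w. w \<in> H \<Longrightarrow> g x + (r - s - adjoint A q) \<bullet> (w - x) \<le> g w"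
    and r: "norm r \<le> R" and s: "norm s \<le> G" and D: "dist x y \<le> D"
  shows "d * norm (adjoint A q) + q \<bullet> (A x - b) \<le> (d + D) * (K + G + R)"
proof -
  let ?\<xi> = "r - s - adjoint A q"
  have rs: "norm (r - s) \<le> R + G"
    using norm_triangle_ineq4[of r s] r s by linarith
  have "(r - s) \<bullet> (x - y) \<le> norm (r - s) * norm (x - y)"
    by (rule norm_cauchy_schwarz)
  also have "\<dots> \<le> (R + G) * D"
    using rs D order_trans[OF norm_ge_zero rs] by (intro mult_mono) (auto simp: dist_norm)
  finally have "(r - s) \<bullet> (x - y) \<le> (R + G) * D" .
  moreover have "d * norm ?\<xi> \<le> K * (d + dist x y) + ?\<xi> \<bullet> (x - y)"
    using lip ball d x sub by (rule subgradient_norm_bound)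
  moreover have "adjoint A q \<bullet> (x - y) = q \<bullet> (A x - b)"
    using adjoint_works[OF lin, of "x - y" q] Ay lin by (simp add: inner_commute linear_diff)
  then have "?\<xi> \<bullet> (x - y) = (r - s) \<bullet> (x - y) - q \<bullet> (A x - b)"
    by (simp add: inner_diff_left)
  moreover have "norm (adjoint A q) \<le> norm ?\<xi> + (R + G)"
    using norm_triangle_ineq4[of "r - s" ?\<xi>] rs by simp
  then have "d * norm (adjoint A q) \<le> d * (norm ?\<xi> + (R + G))"
    using d by (rule mult_left_mono)
  moreover have "K * (d + dist x y) \<le> K * (d + D)"
    using D lipschitz_on_nonneg[OF lip] by (intro mult_left_mono) auto
  ultimately show ?thesis by (simp add: algebra_simps)
qed

text \<open>One outer iteration preserves the bound \<open>B\<close>, independently of the penalty parameter \<open>c\<close>.\<close>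

lemma damped_multiplier_bound:
  fixes q p a :: "'b::real_inner"
  assumes q: "q = (1 - \<theta>) *\<^sub>R p + c *\<^sub>R a" and c: "0 < c" and \<theta>: "0 \<le> \<theta>" "\<theta> \<le> 1"
    and chi: "0 \<le> chi" "chi \<le> 1" and \<tau>: "0 < \<tau>"
    and bound: "\<tau> * norm q + q \<bullet> a \<le> \<beta>"
    and p: "norm p \<le> B" and B: "\<beta> / \<tau> \<le> B"
  shows "norm ((1 - \<theta>) *\<^sub>R p + (chi * c) *\<^sub>R a) \<le> B"
proof -
  have p': "norm ((1 - \<theta>) *\<^sub>R p) \<le> B"
    using mult_right_mono[of "1 - \<theta>" 1 "norm p"] \<theta> p by simp
  have "norm q \<le> B"
  proof (cases "norm q \<le> norm ((1 - \<theta>) *\<^sub>R p)")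
    case False
    have "c * (q \<bullet> a) = q \<bullet> (q - (1 - \<theta>) *\<^sub>R p)"
      using q by simp
    also have "\<dots> = norm q * norm q - q \<bullet> ((1 - \<theta>) *\<^sub>R p)"
      by (simp add: inner_diff_right norm_eq_sqrt_inner)
    also have "\<dots> \<ge> norm q * norm q - norm q * norm ((1 - \<theta>) *\<^sub>R p)"
      using norm_cauchy_schwarz[of q "(1 - \<theta>) *\<^sub>R p"] by linarith
    finally have "c * (q \<bullet> a) \<ge> norm q * (norm q - norm ((1 - \<theta>) *\<^sub>R p))"
      by (simp only: right_diff_distrib)
    moreover have "norm q * (norm q - norm ((1 - \<theta>) *\<^sub>R p)) \<ge> 0"
      using False by (intro mult_nonneg_nonneg) auto
    ultimately have "q \<bullet> a \<ge> 0" using c by (metis order_trans zero_le_mult_iff not_less)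
    then have "norm q \<le> \<beta> / \<tau>"
      using bound \<tau> by (simp add: field_simps)
    then show ?thesis using B by simp
  qed (use p' in simp)
  moreover have "(1 - \<theta>) *\<^sub>R p + (chi * c) *\<^sub>R a = (1 - chi) *\<^sub>R ((1 - \<theta>) *\<^sub>R p) + chi *\<^sub>R q"
    unfolding q by (simp add: algebra_simps)
  ultimately show ?thesis
    using convexD_alt[OF convex_cball[of 0 B], of "(1 - \<theta>) *\<^sub>R p" q chi] p' chi by simp
qed

theorem proposition2p1:
  fixes A :: "real ^ 'n \<Rightarrow> real ^ 'l" and b :: "real ^ 'l"
    and f :: "real ^ 'n \<Rightarrow> real" and h :: "real ^ 'n \<Rightarrow> ereal"
    and H :: "(real ^ 'n) set"
    and m M K_h D_h d_bar G_f lam \<beta>_lam :: real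
    and z_bar z0 :: "real ^ 'n" and p0 :: "real ^ 'l"
    and \<rho> \<eta> c1 \<sigma> chi \<theta> :: real
    and N :: nat
    and z v vhat :: "nat \<Rightarrow> real ^ 'n" and phat p :: "nat \<Rightarrow> real ^ 'l" and c :: "nat \<Rightarrow> real"
  assumes A_linear: "linear A" and A_nonzero: "A \<noteq> (\<lambda>_. 0)"
    and h_proper: "proper_fun h" and h_lsc: "lsc_fun h" and h_convex: "convex_fun h"
    and H_def: "H = effdom h"
    and h_lipschitz: "K_h-lipschitz_on H (\<lambda>x. real_of_ereal (h x))"
    and H_compact: "compact H"
    and D_h_def: "D_h = diameter H"
    and f_diff: "\<forall>x. f differentiable (at x)"
    and m_pos: "0 < m" and m_le_M: "m \<le> M"
    and f_lower_curvature:
      "\<forall>u x. f u - f x - grad f x \<bullet> (u - x) \<ge> - (m / 2) * (norm (u - x))\<^sup>2"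
    and f_grad_lipschitz: "\<forall>u x. norm (grad f u - grad f x) \<le> M * norm (u - x)"
    and z_bar_interior: "z_bar \<in> interior H" and z_bar_feasible: "A z_bar = b"
    and feasible_nonempty: "{x \<in> H. A x = b} \<noteq> {}"
    and phi_bounded_below: "(INF x. ereal (f x) + h x) > -\<infinity>"
    and rho_pos: "\<rho> > 0" and eta_pos: "\<eta> > 0"
    and z0_dom: "z0 \<in> H" and p0_range: "p0 \<in> range A"
    and c1_pos: "c1 > 0"
    and sigma_bounds: "\<sigma> \<in> {0<..1/2}"
    and chi_bounds: "chi \<in> {0<..<1}" and theta_bounds: "\<theta> \<in> {0<..<1}"
    and chi_theta: "(1 - \<theta>) * (2 - \<theta>) * chi \<le> \<theta>\<^sup>2"
    and lam_def: "lam = 1 / (2 * m)"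
    and run: "aidal_run f h A b m M \<rho> \<eta> z0 p0 c1 \<sigma> chi \<theta> N z v vhat phat p c"
    and d_bar_def: "d_bar = infdist z_bar (frontier H)"
    and G_f_def: "G_f = (SUP u\<in>H. norm (grad f u))"
    and beta_def: "\<beta>_lam = (d_bar + D_h) * (K_h + G_f + (1 + \<sigma>) * D_h / lam)"
  shows "\<forall>k\<in>{1..N}. norm (p k) \<le> norm p0 + \<beta>_lam / (d_bar * min_pos_singular_value A)"
proof -
  let ?\<tau> = "d_bar * min_pos_singular_value A"
  let ?B = "norm p0 + \<beta>_lam / ?\<tau>"
  have lam: "0 < lam" using lam_def m_pos by simp
  define g where "g = (\<lambda>x. real_of_ereal (h x))"
  have hg: "h x = (if x \<in> H then ereal (g x) else \<infinity>)" for x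
    using h_proper unfolding H_def g_def proper_fun_def effdom_def
    by (cases "h x") auto
  have g_conv: "convex_on H g"
  proof (intro convex_onI)
    have seg: "(1 - t) *\<^sub>R x + t *\<^sub>R y \<in> H \<and> g ((1 - t) *\<^sub>R x + t *\<^sub>R y) \<le> (1 - t) * g x + t * g y"
      if "x \<in> H" "y \<in> H" "0 \<le> t" "t \<le> 1" for x y t
    proof -
      have "h ((1 - t) *\<^sub>R x + t *\<^sub>R y) \<le> ereal (1 - t) * h x + ereal t * h y"
        using h_convex that by (auto simp: convex_fun_def)
      then show ?thesis using that by (auto simp: hg split: if_splits)
    qed
    then show "g ((1 - t) *\<^sub>R x + t *\<^sub>R y) \<le> (1 - t) * g x + t * g y"
      if "0 < t" "t < 1" "x \<in> H" "y \<in> H" for t x y using that by simp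
    show "convex H" using seg by (simp add: convex_alt)
  qed
  have g_lip: "K_h-lipschitz_on H g" using h_lipschitz by (simp add: g_def)
  have Hne: "H \<noteq> {}" using z0_dom by blast
  have zbH: "z_bar \<in> H" using z_bar_interior interior_subset by blast
  have Hcl: "closed H" using H_compact by (rule compact_imp_closed)
  have "H \<noteq> UNIV" using H_compact not_bounded_UNIV compact_imp_bounded by metis
  then have "frontier H \<noteq> {}" using Hne by (simp add: frontier_eq_empty)
  then have d_pos: "0 < d_bar"
    using z_bar_interior unfolding d_bar_def
    by (intro infdist_pos_not_in_closed) (auto simp: frontier_def)
  have ball: "cball z_bar d_bar \<subseteq> H"
    unfolding d_bar_def using Hcl zbH by (rule cball_infdist_frontier_subset)
  have \<tau>: "0 < ?\<tau>"
    using d_pos min_pos_singular_value_lower_bound(1)[OF A_linear A_nonzero] by simp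
  have D: "dist x y \<le> D_h" if "x \<in> H" "y \<in> H" for x y
    unfolding D_h_def using H_compact that
    by (intro diameter_bounded_bound compact_imp_bounded)
  have G: "norm (grad f x) \<le> G_f" if "x \<in> H" for x
  proof -
    have "norm (grad f u) \<le> norm (grad f z_bar) + M * D_h" if "u \<in> H" for u
    proof -
      have "norm (grad f u - grad f z_bar) \<le> M * norm (u - z_bar)"
        using f_grad_lipschitz by blast
      also have "\<dots> \<le> M * D_h"
        using D[OF that zbH] m_pos m_le_M by (intro mult_left_mono) (auto simp: dist_norm)
      finally show ?thesis using norm_triangle_sub[of "grad f u" "grad f z_bar"] by linarith
    qed
    then have "bdd_above ((\<lambda>u. norm (grad f u)) ` H)" by (rule bdd_aboveI2)
    then show ?thesis unfolding G_f_def using that by (intro cSUP_upper)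
  qed
  have "0 \<le> \<beta>_lam"
    unfolding beta_def
    using d_pos D[OF zbH zbH] G[OF zbH] lipschitz_on_nonneg[OF g_lip] sigma_bounds lam
      order_trans[OF norm_ge_zero G[OF zbH]]
    by (intro mult_nonneg_nonneg add_nonneg_nonneg divide_nonneg_nonneg) auto
  then have B: "norm p0 \<le> ?B" "\<beta>_lam / ?\<tau> \<le> ?B" using \<tau> by auto
  note run' = run[unfolded aidal_run_def Let_def, folded lam_def]
  have init: "z 0 = z0" "p 0 = p0" "c 1 = c1" using run' by auto
  have step: "acg_output
        (\<lambda>x. lam * smooth_lagrangian f A b \<theta> (c k) x (p (k - 1)) + 1 / 2 * (norm (x - z (k - 1)))\<^sup>2)
        (\<lambda>x. ereal lam * h x)
        (lam * (M + c k * (onorm A)\<^sup>2) + 1) (1 / 2) \<sigma> (z (k - 1)) (z k, v k)"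
      "vhat k = (1 / lam) *\<^sub>R (v k + z (k - 1) - z k)"
      "phat k = (1 - \<theta>) *\<^sub>R p (k - 1) + c k *\<^sub>R (A (z k) - b)"
      "p k = (1 - \<theta>) *\<^sub>R p (k - 1) + (chi * c k) *\<^sub>R (A (z k) - b)"
    if "k \<in> {1..N}" for k
    using run' that by auto
  have c_step: "c (Suc k) = (if norm (vhat k) \<le> \<rho> then 2 * c k else c k)" if "k \<in> {1..<N}" for k
    using run' that by auto
  have c_pos: "0 < c (Suc k)" if "Suc k \<le> N" for k
    using that
  proof (induction k)
    case 0
    then show ?case using init(3) c1_pos by simp
  next
    case (Suc k)
    then show ?case using c_step[of "Suc k"] by simp
  qed
  have lam_h: "ereal lam * h x = (if x \<in> H then ereal (lam * g x) else \<infinity>)" for x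
    using lam by (simp add: hg)
  have lam_g: "convex_on H (\<lambda>x. lam * g x)"
    using lam g_conv by (intro convex_on_cmul) auto
  have b_range: "b \<in> range A" using z_bar_feasible by blast
  have subr: "subspace (range A)"
    using A_linear by (intro linear_subspace_image) auto
  have main: "z k \<in> H \<and> p k \<in> range A \<and> norm (p k) \<le> ?B" if "k \<le> N" for k
    using that
  proof (induction k)
    case 0
    then show ?case using init z0_dom p0_range B(1) by simp
  next
    case (Suc k)
    then have IH: "z k \<in> H" "p k \<in> range A" "norm (p k) \<le> ?B" and k: "Suc k \<in> {1..N}" by auto
    let ?q = "phat (Suc k)"
    note st = step[OF k, simplified]
    note acg = acg_output_subgradient[OF lam_h lam_g Hne step(1)[OF k], simplified]
    have res: "A (z (Suc k)) - b \<in> range A"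
      using subr b_range by (intro subspace_diff) auto
    have q_range: "?q \<in> range A" and p_range: "p (Suc k) \<in> range A"
      unfolding st using subr IH(2) res by (auto intro!: subspace_add subspace_scale)
    have "norm (v (Suc k) + (z k - z (Suc k))) \<le> (1 + \<sigma>) * norm (z (Suc k) - z k)"
      using norm_triangle_ineq[of "v (Suc k)" "z k - z (Suc k)"] acg(2)
      by (simp add: norm_minus_commute algebra_simps)
    also have "\<dots> \<le> (1 + \<sigma>) * D_h"
      using D[OF acg(1) IH(1)] sigma_bounds by (intro mult_left_mono) (auto simp: dist_norm)
    finally have vhat: "norm (vhat (Suc k)) \<le> (1 + \<sigma>) * D_h / lam"
      unfolding st using lam by (simp add: divide_right_mono add_diff_eq)
    have sub: "g (z (Suc k)) + (vhat (Suc k) - grad f (z (Suc k)) - adjoint A ?q) \<bullet> (w - z (Suc k)) \<le> g w"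
      if "w \<in> H" for w
    proof -
      have gr: "grad (\<lambda>x. lam * smooth_lagrangian f A b \<theta> (c (Suc k)) x (p k)
          + 1 / 2 * (norm (x - z k))\<^sup>2) (z (Suc k))
        = lam *\<^sub>R (grad f (z (Suc k)) + adjoint A ?q) + (z (Suc k) - z k)"
        unfolding st(3) by (rule grad_prox_smooth_lagrangian[OF A_linear]) (use f_diff in blast)
      have "lam *\<^sub>R (vhat (Suc k) - grad f (z (Suc k)) - adjoint A ?q)
        = v (Suc k) - (lam *\<^sub>R (grad f (z (Suc k)) + adjoint A ?q) + (z (Suc k) - z k))"
        unfolding st(2) using lam by (simp add: algebra_simps)
      then have "lam * (g (z (Suc k))
          + (vhat (Suc k) - grad f (z (Suc k)) - adjoint A ?q) \<bullet> (w - z (Suc k))) \<le> lam * g w"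
        using acg(3)[OF that] gr by (simp add: distrib_left flip: inner_scaleR_left)
      then show ?thesis using lam by simp
    qed
    have "d_bar * norm (adjoint A ?q) + ?q \<bullet> (A (z (Suc k)) - b) \<le> \<beta>_lam"
      unfolding beta_def
      by (rule approximate_kkt_multiplier_bound[OF A_linear z_bar_feasible g_lip ball
            less_imp_le[OF d_pos] acg(1) sub vhat G[OF acg(1)] D[OF acg(1) zbH]])
    moreover have "?\<tau> * norm ?q \<le> d_bar * norm (adjoint A ?q)"
      using min_pos_singular_value_adjoint_bound[OF A_linear A_nonzero q_range] d_pos
      by (simp add: mult.assoc)
    ultimately have "?\<tau> * norm ?q + ?q \<bullet> (A (z (Suc k)) - b) \<le> \<beta>_lam" by linarith
    then have "norm (p (Suc k)) \<le> ?B"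
      unfolding st(4) using theta_bounds chi_bounds c_pos[of k] k \<tau> IH(3) B(2)
      by (intro damped_multiplier_bound[OF st(3)]) auto
    then show ?case using acg(1) p_range by simp
  qed
  then show ?thesis by simp
qed

end
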